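(* Let $\Sigma$ be a finite alphabet, let $Y\subset\Sigma^{\mathbb{N}}$ be a sofic shift all of whose transitive components are mixing, let $X$ be a topological space, and let $f : X \to Y$ and $g : X \to Y$ be functions that are continuous with respect to the Besicovitch topology on $Y$. If for all $x \in X$ there exists a transitive component $Z_x$ of $Y$ such that $f(x) \in \tilde Z_x$ and $g(x) \in \tilde Z_x$, then $f$ and $g$ are homotopic with respect to the Besicovitch topology on $Y$, i.e. there is a continuous $h:[0,1]\times X\to Y$ with $h(0,x)=f(x)$ and $h(1,x)=g(x)$ for all $x\in X$.
   Context: Subshifts here are one-sided: a subshift is a subset of $\Sigma^{\mathbb{N}}$ that is closed in the product (Cantor) topology and shift-invariant, where the shift is $\sigma(x)_i = x_{i+1}$. A sofic shift is a subshift presented by a finite labeled graph. A subshift is transitive if it is nonempty and for all words $u,v$ occurring in it there is a word $w$ such that $uwv$ occurs in it; a sofic shift is mixing if it is nonempty and there is $m$ such that for all words $u,v$ occurring in it and all $n\ge m$ there is $w$ of length $n$ such that $uwv$ occurs in it. The transitive components of a sofic shift are its maximal (with respect to inclusion) transitive subshifts. The Besicovitch topology on $\Sigma^{\mathbb{N}}$ is the (not necessarily Hausdorff) topology given by the pseudometric $d_B(x,y)=\limsup_{n\to\infty} \frac{1}{n+1}|\{i\in[0,n] : x_i\neq y_i\}|$. For $Z \subset \Sigma^{\mathbb{N}}$, $\tilde Z = \{y \in \Sigma^{\mathbb{N}} : \exists z \in Z,\ d_B(y,z)=0\}$. *)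

theory Defs
  imports "HOL-Analysis.Analysis"
begin

section \<open>One-sided subshifts\<close>

text \<open>
  A configuration over the alphabet \<open>A\<close> is a function in \<open>UNIV \<rightarrow> A\<close>, with \<open>UNIV :: nat set\<close>.
\<close>

definition shift :: "(nat \<Rightarrow> 'a) \<Rightarrow> nat \<Rightarrow> 'a" where
  "shift x = (\<lambda>i. x (Suc i))"

definition cantor_topology :: "'a set \<Rightarrow> (nat \<Rightarrow> 'a) topology" where
  "cantor_topology A = product_topology (\<lambda>_. discrete_topology A) UNIV"

lemma topspace_cantor_topology: "topspace (cantor_topology A) = (UNIV \<rightarrow> A)"
  by (simp add: cantor_topology_def PiE_UNIV_domain)

text \<open>
  Shift invariance is \<open>shift ` X \<subseteq> X\<close>; surjectivity of the shift on \<open>X\<close> is not required.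
  Closedness in \<^term>\<open>cantor_topology A\<close> includes \<open>X \<subseteq> (UNIV \<rightarrow> A)\<close>.
\<close>

definition subshift :: "'a set \<Rightarrow> (nat \<Rightarrow> 'a) set \<Rightarrow> bool" where
  "subshift A X \<longleftrightarrow> closedin (cantor_topology A) X \<and> shift ` X \<subseteq> X"

definition language :: "(nat \<Rightarrow> 'a) set \<Rightarrow> 'a list set" where
  "language X = {map x [i..<i + n] | x i n. x \<in> X}"

text \<open>
  A labeled graph is given by its set of edges \<open>(source, label, target)\<close>. Isolated vertices
  and parallel edges with equal labels do not affect the set of label sequences of infinite walks.
\<close>

definition walk_labels :: "('v \<times> 'a \<times> 'v) set \<Rightarrow> (nat \<Rightarrow> 'a) set" where
  "walk_labels E = {x. \<exists>q. \<forall>i. (q i, x i, q (Suc i)) \<in> E}"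

text \<open>
  A finite graph has, up to isomorphism, natural numbers as vertices; see \<open>sofic_walk_labels\<close>
  below for graphs over other vertex types.
\<close>

definition sofic :: "'a set \<Rightarrow> (nat \<Rightarrow> 'a) set \<Rightarrow> bool" where
  "sofic A X \<longleftrightarrow> subshift A X \<and>
     (\<exists>E :: (nat \<times> 'a \<times> nat) set. finite E \<and> X = walk_labels E)"

lemma sofic_walk_labels:
  fixes E :: "('v \<times> 'a \<times> 'v) set"
  assumes "finite E" and "subshift A (walk_labels E)"
  shows "sofic A (walk_labels E)"
proof -
  define V where "V = fst ` E \<union> (snd \<circ> snd) ` E"
  have "finite V" using assms(1) by (simp add: V_def)
  then obtain h :: "'v \<Rightarrow> nat" where h: "inj_on h V"
    using finite_imp_inj_to_nat_seg by blast
  define F where "F = (\<lambda>(p, a, q). (h p, a, h q)) ` E"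
  have V: "p \<in> V" "q \<in> V" if "(p, a, q) \<in> E" for p a q
    using that by (force simp: V_def)+
  have "walk_labels E = walk_labels F"
  proof (intro equalityI subsetI)
    fix x assume "x \<in> walk_labels E"
    then obtain q where "\<forall>i. (q i, x i, q (Suc i)) \<in> E" by (auto simp: walk_labels_def)
    then have "\<forall>i. ((h \<circ> q) i, x i, (h \<circ> q) (Suc i)) \<in> F"
      unfolding F_def by force
    then show "x \<in> walk_labels F" unfolding walk_labels_def by blast
  next
    fix x assume "x \<in> walk_labels F"
    then obtain r where r: "\<And>i. (r i, x i, r (Suc i)) \<in> F" by (auto simp: walk_labels_def)
    have "(inv_into V h (r i), x i, inv_into V h (r (Suc i))) \<in> E" for i
    proof -
      obtain p q where "(p, x i, q) \<in> E" "r i = h p" "r (Suc i) = h q"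
        using r[of i] by (auto simp: F_def)
      then show ?thesis using V h by (simp add: inv_into_f_f)
    qed
    then show "x \<in> walk_labels E"
      unfolding walk_labels_def by (intro CollectI exI[of _ "\<lambda>i. inv_into V h (r i)"]) blast
  qed
  moreover have "finite F" using assms(1) by (simp add: F_def)
  ultimately show ?thesis using assms(2) unfolding sofic_def by blast
qed

definition transitive :: "(nat \<Rightarrow> 'a) set \<Rightarrow> bool" where
  "transitive X \<longleftrightarrow> X \<noteq> {} \<and>
     (\<forall>u \<in> language X. \<forall>v \<in> language X. \<exists>w. u @ w @ v \<in> language X)"

definition mixing :: "(nat \<Rightarrow> 'a) set \<Rightarrow> bool" where
  "mixing X \<longleftrightarrow> X \<noteq> {} \<and>
     (\<exists>m. \<forall>u \<in> language X. \<forall>v \<in> language X. \<forall>n \<ge> m.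
        \<exists>w. length w = n \<and> u @ w @ v \<in> language X)"

definition transitive_component ::
  "'a set \<Rightarrow> (nat \<Rightarrow> 'a) set \<Rightarrow> (nat \<Rightarrow> 'a) set \<Rightarrow> bool" where
  "transitive_component A Y Z \<longleftrightarrow>
     subshift A Z \<and> transitive Z \<and> Z \<subseteq> Y \<and>
     (\<forall>Z'. subshift A Z' \<and> transitive Z' \<and> Z' \<subseteq> Y \<and> Z \<subseteq> Z' \<longrightarrow> Z' = Z)"

section \<open>The Besicovitch topology\<close>

text \<open>
  The limit superior is taken in \<^typ>\<open>ereal\<close>; it lies between 0 and 1 (lemma
  \<open>ereal_besicovitch_dist\<close>), so the conversion to \<^typ>\<open>real\<close> loses nothing.
\<close>

definition besicovitch_dist :: "(nat \<Rightarrow> 'a) \<Rightarrow> (nat \<Rightarrow> 'a) \<Rightarrow> real" where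
  "besicovitch_dist x y =
     real_of_ereal (limsup (\<lambda>n. ereal (real (card {i \<in> {0..n}. x i \<noteq> y i}) / real (n + 1))))"

lemma ereal_besicovitch_dist:
  "ereal (besicovitch_dist x y) =
     limsup (\<lambda>n. ereal (real (card {i \<in> {0..n}. x i \<noteq> y i}) / real (n + 1)))"
  (is "_ = limsup ?f")
proof -
  have "card {i \<in> {0..n}. x i \<noteq> y i} \<le> n + 1" for n
    using card_mono[of "{0..n}" "{i \<in> {0..n}. x i \<noteq> y i}"] by (simp add: subset_eq)
  then have "real (card {i \<in> {0..n}. x i \<noteq> y i}) \<le> real (n + 1)" for n
    by (simp only: of_nat_le_iff)
  then have "?f n \<le> 1" for n by (simp add: one_ereal_def)
  then have "limsup ?f \<le> 1" by (intro Limsup_bounded) auto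
  moreover have "0 \<le> limsup ?f" by (intro le_Limsup) (auto simp: zero_ereal_def)
  ultimately have "\<bar>limsup ?f\<bar> \<noteq> \<infinity>" by auto
  then show ?thesis unfolding besicovitch_dist_def by (simp add: ereal_real)
qed

lemma besicovitch_dist_nonneg: "0 \<le> besicovitch_dist x y"
proof -
  have "0 \<le> ereal (besicovitch_dist x y)"
    unfolding ereal_besicovitch_dist by (intro le_Limsup) (auto simp: zero_ereal_def)
  then show ?thesis by simp
qed

lemma besicovitch_dist_refl: "besicovitch_dist x x = 0"
  by (simp add: besicovitch_dist_def Limsup_const flip: zero_ereal_def)

lemma besicovitch_dist_commute: "besicovitch_dist x y = besicovitch_dist y x"
  by (simp add: besicovitch_dist_def eq_commute)

lemma besicovitch_dist_triangle:
  "besicovitch_dist x z \<le> besicovitch_dist x y + besicovitch_dist y z"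
proof -
  let ?d = "\<lambda>x y n. ereal (real (card {i \<in> {0..n}. x i \<noteq> y i}) / real (n + 1))"
  have "?d x z n \<le> ?d x y n + ?d y z n" for n
  proof -
    have "card {i \<in> {0..n}. x i \<noteq> z i}
        \<le> card ({i \<in> {0..n}. x i \<noteq> y i} \<union> {i \<in> {0..n}. y i \<noteq> z i})"
      by (intro card_mono) auto
    also have "\<dots> \<le> card {i \<in> {0..n}. x i \<noteq> y i} + card {i \<in> {0..n}. y i \<noteq> z i}"
      by (rule card_Un_le)
    finally show ?thesis
      by (simp add: divide_right_mono flip: add_divide_distrib of_nat_add)
  qed
  then have "limsup (?d x z) \<le> limsup (\<lambda>n. ?d x y n + ?d y z n)"
    by (intro Limsup_mono) auto
  also have "\<dots> \<le> limsup (?d x y) + limsup (?d y z)"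
    by (rule ereal_limsup_add_mono)
  finally have "ereal (besicovitch_dist x z)
      \<le> ereal (besicovitch_dist x y) + ereal (besicovitch_dist y z)"
    unfolding ereal_besicovitch_dist .
  then show ?thesis by simp
qed

text \<open>
  Distinct configurations may have distance 0, so this is not an instance of
  \<^locale>\<open>Metric_space\<close>.
\<close>

definition besicovitch_topology :: "'a set \<Rightarrow> (nat \<Rightarrow> 'a) topology" where
  "besicovitch_topology A = topology (\<lambda>U. U \<subseteq> (UNIV \<rightarrow> A) \<and>
     (\<forall>x\<in>U. \<exists>\<epsilon>>0. \<forall>y \<in> UNIV \<rightarrow> A. besicovitch_dist x y < \<epsilon> \<longrightarrow> y \<in> U))"

lemma openin_besicovitch_topology:
  "openin (besicovitch_topology A) U \<longleftrightarrow> U \<subseteq> (UNIV \<rightarrow> A) \<and>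
     (\<forall>x\<in>U. \<exists>\<epsilon>>0. \<forall>y \<in> UNIV \<rightarrow> A. besicovitch_dist x y < \<epsilon> \<longrightarrow> y \<in> U)"
proof -
  have "istopology (\<lambda>U. U \<subseteq> (UNIV \<rightarrow> A) \<and>
     (\<forall>x\<in>U. \<exists>\<epsilon>>0. \<forall>y \<in> UNIV \<rightarrow> A. besicovitch_dist x y < \<epsilon> \<longrightarrow> y \<in> U))" (is "istopology ?P")
    unfolding istopology_def
  proof (intro conjI allI impI)
    fix S T assume S: "?P S" and T: "?P T"
    show "S \<inter> T \<subseteq> (UNIV \<rightarrow> A)" using S by blast
    show "\<forall>x\<in>S \<inter> T. \<exists>\<epsilon>>0. \<forall>y \<in> UNIV \<rightarrow> A. besicovitch_dist x y < \<epsilon> \<longrightarrow> y \<in> S \<inter> T"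
    proof
      fix x assume "x \<in> S \<inter> T"
      then obtain d e where "d > 0" "\<forall>y \<in> UNIV \<rightarrow> A. besicovitch_dist x y < d \<longrightarrow> y \<in> S"
        and "e > 0" "\<forall>y \<in> UNIV \<rightarrow> A. besicovitch_dist x y < e \<longrightarrow> y \<in> T"
        using S T by blast
      then show "\<exists>\<epsilon>>0. \<forall>y \<in> UNIV \<rightarrow> A. besicovitch_dist x y < \<epsilon> \<longrightarrow> y \<in> S \<inter> T"
        by (intro exI[of _ "min d e"]) auto
    qed
  next
    fix \<K> assume K: "\<forall>K\<in>\<K>. ?P K"
    then show "\<Union>\<K> \<subseteq> (UNIV \<rightarrow> A)" by blast
    show "\<forall>x\<in>\<Union>\<K>. \<exists>\<epsilon>>0. \<forall>y \<in> UNIV \<rightarrow> A. besicovitch_dist x y < \<epsilon> \<longrightarrow> y \<in> \<Union>\<K>"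
      using K by (meson UnionE UnionI)
  qed
  then show ?thesis by (simp add: besicovitch_topology_def topology_inverse')
qed

lemma topspace_besicovitch_topology: "topspace (besicovitch_topology A) = (UNIV \<rightarrow> A)"
proof
  show "topspace (besicovitch_topology A) \<subseteq> (UNIV \<rightarrow> A)"
    using openin_topspace openin_besicovitch_topology by blast
  have "openin (besicovitch_topology A) (UNIV \<rightarrow> A)"
    unfolding openin_besicovitch_topology using zero_less_one by blast
  then show "(UNIV \<rightarrow> A) \<subseteq> topspace (besicovitch_topology A)"
    by (rule openin_subset)
qed

definition besicovitch_saturation :: "'a set \<Rightarrow> (nat \<Rightarrow> 'a) set \<Rightarrow> (nat \<Rightarrow> 'a) set" where
  "besicovitch_saturation A Z = {y \<in> UNIV \<rightarrow> A. \<exists>z\<in>Z. besicovitch_dist y z = 0}"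

end

theory Submission
  imports Defs "HOL-Real_Asymp.Real_Asymp"
begin

text \<open>
  Let \<open>S t\<close> be the set of all \<open>i\<close> with \<open>frac (sqrt i) < t\<close>. At time \<open>t\<close> the homotopy takes the
  coordinates in \<open>S t\<close> from \<open>g x\<close> and the others from \<open>f x\<close>. This path is Lipschitz in \<open>t\<close>
  because \<open>S t - S s\<close> has upper density at most \<open>t - s\<close>. Since \<open>S t\<close> is a union of intervals whose
  endpoints have density zero, mixing of the component \<open>Z\<close> allows repairing the transitions with
  words of a fixed length: some point of \<open>Z\<close> has Besicovitch distance 0 to the interleaved
  configuration, and passing to a point at distance 0 does not affect continuity.
\<close>

section \<open>The Besicovitch pseudometric\<close>

text \<open>Lets counting bounds replace limsup computations: an explicit bound \<open>b n\<close>
  on the number of disagreements is compared with \<open>n + 1\<close> by an ordinary limit.\<close>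

lemma besicovitch_dist_le:
  assumes "\<And>n. real (card {i \<in> {0..n}. x i \<noteq> y i}) \<le> b n"
    and "(\<lambda>n. b n / real (n + 1)) \<longlonglongrightarrow> e"
  shows "besicovitch_dist x y \<le> e"
proof -
  have "limsup (\<lambda>n. ereal (real (card {i \<in> {0..n}. x i \<noteq> y i}) / real (n + 1)))
      \<le> limsup (\<lambda>n. ereal (b n / real (n + 1)))"
    using assms(1) by (intro Limsup_mono always_eventually allI) (simp add: divide_right_mono)
  also have "\<dots> = ereal e"
    using assms(2) by (intro lim_imp_Limsup) auto
  finally have "ereal (besicovitch_dist x y) \<le> ereal e" unfolding ereal_besicovitch_dist .
  then show ?thesis by simp
qed

text \<open>The disagreements of \<open>x\<close> and \<open>y\<close> lie in the union of two
  disagreement sets, and limsup is subadditive. The case of interest has interleavings for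
  \<open>x\<close> and \<open>y\<close>, with each coordinate copied from one of two pairs.\<close>

lemma besicovitch_dist_le_add:
  assumes "\<And>i. x i \<noteq> y i \<Longrightarrow> u i \<noteq> u' i \<or> v i \<noteq> v' i"
  shows "besicovitch_dist x y \<le> besicovitch_dist u u' + besicovitch_dist v v'"
proof -
  let ?d = "\<lambda>x y n. ereal (real (card {i \<in> {0..n}. x i \<noteq> y i}) / real (n + 1))"
  have "?d x y n \<le> ?d u u' n + ?d v v' n" for n
  proof -
    have "card {i \<in> {0..n}. x i \<noteq> y i}
        \<le> card ({i \<in> {0..n}. u i \<noteq> u' i} \<union> {i \<in> {0..n}. v i \<noteq> v' i})"
      using assms by (intro card_mono) auto
    also have "\<dots> \<le> card {i \<in> {0..n}. u i \<noteq> u' i} + card {i \<in> {0..n}. v i \<noteq> v' i}"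
      by (rule card_Un_le)
    finally show ?thesis
      by (simp add: divide_right_mono flip: add_divide_distrib of_nat_add)
  qed
  then have "limsup (?d x y) \<le> limsup (\<lambda>n. ?d u u' n + ?d v v' n)"
    by (intro Limsup_mono) auto
  also have "\<dots> \<le> limsup (?d u u') + limsup (?d v v')"
    by (rule ereal_limsup_add_mono)
  finally have "ereal (besicovitch_dist x y)
      \<le> ereal (besicovitch_dist u u') + ereal (besicovitch_dist v v')"
    unfolding ereal_besicovitch_dist .
  then show ?thesis by simp
qed

lemma openin_besicovitch_ball:
  "openin (besicovitch_topology A) {y \<in> UNIV \<rightarrow> A. besicovitch_dist x y < e}"
  unfolding openin_besicovitch_topology
proof (intro conjI ballI)
  fix y assume y: "y \<in> {y \<in> UNIV \<rightarrow> A. besicovitch_dist x y < e}"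
  have "besicovitch_dist x z < e" if "besicovitch_dist y z < e - besicovitch_dist x y" for z
    using besicovitch_dist_triangle[of x z y] that by linarith
  then show "\<exists>\<epsilon>>0. \<forall>z\<in>UNIV \<rightarrow> A. besicovitch_dist y z < \<epsilon> \<longrightarrow>
      z \<in> {y \<in> UNIV \<rightarrow> A. besicovitch_dist x y < e}"
    using y by (intro exI[of _ "e - besicovitch_dist x y"]) auto
qed auto

text \<open>Epsilon criterion for maps into a pseudometric topology. Since \<open>X\<close> is an
  arbitrary topological space, neighbourhoods \<open>U\<close> take the place of a delta: one
  direction pulls back a ball, the other finds a ball inside a given open set.\<close>

lemma continuous_map_besicovitch_iff:
  "continuous_map X (besicovitch_topology A) f \<longleftrightarrow>
     f \<in> topspace X \<rightarrow> (UNIV \<rightarrow> A) \<and>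
     (\<forall>x\<in>topspace X. \<forall>e>0. \<exists>U. openin X U \<and> x \<in> U \<and>
        (\<forall>y\<in>U. besicovitch_dist (f x) (f y) < e))" (is "?L \<longleftrightarrow> ?R")
proof
  assume L: ?L
  show ?R
  proof (intro conjI ballI allI impI)
    show range: "f \<in> topspace X \<rightarrow> (UNIV \<rightarrow> A)"
      using continuous_map_funspace[OF L] by (simp add: topspace_besicovitch_topology)
    fix x and e :: real assume x: "x \<in> topspace X" and "e > 0"
    define U where
      "U = {z \<in> topspace X. f z \<in> {y \<in> UNIV \<rightarrow> A. besicovitch_dist (f x) y < e}}"
    have "openin X U"
      unfolding U_def by (rule openin_continuous_map_preimage[OF L openin_besicovitch_ball])
    moreover have "x \<in> U"
      using x \<open>e > 0\<close> range by (auto simp: U_def besicovitch_dist_refl)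
    ultimately show "\<exists>U. openin X U \<and> x \<in> U \<and> (\<forall>y\<in>U. besicovitch_dist (f x) (f y) < e)"
      by (intro exI[of _ U]) (auto simp: U_def)
  qed
next
  assume R: ?R
  show ?L
    unfolding continuous_map_def topspace_besicovitch_topology
  proof (intro conjI allI impI)
    fix V assume V: "openin (besicovitch_topology A) V"
    show "openin X {x \<in> topspace X. f x \<in> V}"
    proof (subst openin_subopen, intro ballI)
      fix x assume x: "x \<in> {x \<in> topspace X. f x \<in> V}"
      then obtain e where "e > 0"
        and e: "\<And>y. y \<in> UNIV \<rightarrow> A \<Longrightarrow> besicovitch_dist (f x) y < e \<Longrightarrow> y \<in> V"
        using V unfolding openin_besicovitch_topology by blast
      then obtain U where U: "openin X U" "x \<in> U" "\<forall>y\<in>U. besicovitch_dist (f x) (f y) < e"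
        using R x by blast
      have "U \<subseteq> topspace X" using U(1) by (rule openin_subset)
      then have "U \<subseteq> {x \<in> topspace X. f x \<in> V}"
        using U(3) e R by blast
      then show "\<exists>T. openin X T \<and> x \<in> T \<and> T \<subseteq> {x \<in> topspace X. f x \<in> V}"
        using U by blast
    qed
  qed (use R in blast)
qed

section \<open>Gluing in mixing subshifts\<close>

lemma funpow_shift: "(shift ^^ k) x i = x (k + i)"
  by (induction k arbitrary: i) (simp_all add: shift_def)

text \<open>Shift invariance moves an occurrence at position \<open>k\<close> to position 0, so
  every word of the language begins some point of \<open>Z\<close>.\<close>

lemma language_prefixE:
  assumes "subshift A Z" and "s \<in> language Z"
  obtains z where "z \<in> Z" and "map z [0..<length s] = s"
proof -
  obtain x k n where x: "x \<in> Z" and s: "s = map x [k..<k + n]"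
    using assms(2) by (auto simp: language_def)
  have "(shift ^^ k) x \<in> Z"
    using assms(1) x by (induction k) (auto simp: subshift_def)
  moreover have "map ((shift ^^ k) x) [0..<length s] = s"
    unfolding s by (intro nth_equalityI) (auto simp: funpow_shift)
  ultimately show ?thesis by (rule that)
qed

lemma map_in_language:
  assumes "z \<in> Z"
  shows "map z [a..<b] \<in> language Z"
proof -
  have "map z [a..<b] = map z [a..<a + (b - a)]" by (cases "a \<le> b") auto
  then show ?thesis using assms unfolding language_def by blast
qed

text \<open>\<open>D\<close> is a set of cuts; a piece may start at a cut, hence the interval open
  at \<open>a\<close>. Each cut \<open>j\<close> is followed by a window of length \<open>m\<close>,
  which is sacrificed to a connecting word. Overlapping windows are harmless, because nothing is
  demanded inside any of them.\<close>

lemma glue_prefix: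
  assumes Z: "subshift A Z" "Z \<noteq> {}"
    and mix: "\<And>u v. u \<in> language Z \<Longrightarrow> v \<in> language Z \<Longrightarrow>
       \<exists>w. length w = m \<and> u @ w @ v \<in> language Z"
    and "0 \<in> D"
    and pieces: "\<And>a b. {a<..<b} \<inter> D = {} \<Longrightarrow> \<exists>p\<in>Z. \<forall>i\<in>{a..<b}. y i = p i"
  shows "\<exists>z\<in>Z. \<forall>i<n. (\<forall>j\<in>D. i \<notin> {j..<j + m}) \<longrightarrow> z i = y i"
proof (induction n rule: less_induct)
  case (less n)
  show ?case
  proof (cases "n = 0")
    case True
    then show ?thesis using Z(2) by auto
  next
    case False
    define C where "C = {j \<in> D. j < n}"
    have C: "finite C" "C \<noteq> {}" using False \<open>0 \<in> D\<close> by (auto simp: C_def)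
    define d where "d = Max C"
    \<comment> \<open>\<open>d\<close> is the last cut before \<open>n\<close>; one exists because
      \<open>0 \<in> D\<close>. From \<open>d\<close> to \<open>n\<close> the target
      \<open>y\<close> follows a single point of \<open>Z\<close>.\<close>
    have d: "d \<in> D" "d < n" using Max_in[OF C] by (auto simp: C_def d_def)
    have "j \<le> d" if "j \<in> D" "j < n" for j
      unfolding d_def using C(1) that by (intro Max_ge) (auto simp: C_def)
    then have "{d<..<n} \<inter> D = {}" by fastforce
    then obtain p where p: "p \<in> Z" "\<And>i. d \<le> i \<Longrightarrow> i < n \<Longrightarrow> y i = p i"
      using pieces by fastforce
    obtain z where z: "z \<in> Z" "\<And>i. i < d \<Longrightarrow> \<forall>j\<in>D. i \<notin> {j..<j + m} \<Longrightarrow> z i = y i"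
      using less[OF d(2)] by blast
    show ?thesis
    proof (cases "n \<le> d + m")
      case True
      \<comment> \<open>The window after \<open>d\<close> reaches \<open>n\<close>, so the point
        obtained for the shorter prefix already serves.\<close>
      have "z i = y i" if "i < n" "\<forall>j\<in>D. i \<notin> {j..<j + m}" for i
        using z(2)[of i] that True d by force
      then show ?thesis using z(1) by blast
    next
      case False
      \<comment> \<open>The connecting word fills exactly the window after \<open>d\<close>, so
        \<open>p\<close> resumes at position \<open>d + m\<close> without displacement.\<close>
      obtain w where w: "length w = m"
        "map z [0..<d] @ w @ map p [d + m..<n] \<in> language Z" (is "?s \<in> _")
        using mix map_in_language z(1) p(1) by blast
      obtain z' where z': "z' \<in> Z" "map z' [0..<length ?s] = ?s"
        using language_prefixE[OF Z(1) w(2)] .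
      have len: "length ?s = n" using w(1) False by simp
      have nth: "z' i = ?s ! i" if "i < n" for i
        using arg_cong[OF z'(2), of "\<lambda>l. l ! i"] that len by simp
      have "z' i = y i" if i: "i < n" "\<forall>j\<in>D. i \<notin> {j..<j + m}" for i
      proof (cases "i < d")
        case True
        then show ?thesis using nth[OF i(1)] z(2)[OF True i(2)] by (simp add: nth_append)
      next
        case False
        then have "d + m \<le> i" using i(2) d(1) by force
        then show ?thesis using nth[OF i(1)] p(2)[of i] i(1) w(1) by (auto simp: nth_append)
      qed
      then show ?thesis using z'(1) by blast
    qed
  qed
qed

section \<open>From prefixes to points by compactness\<close>

lemma compact_space_cantor_topology: "finite A \<Longrightarrow> compact_space (cantor_topology A)"
  by (simp add: cantor_topology_def compact_space_product_topology compact_space_discrete_topology)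

lemma closedin_cantor_cylinder:
  "closedin (cantor_topology A) {z \<in> UNIV \<rightarrow> A. z i = a}"
proof -
  have "continuous_map (cantor_topology A) (discrete_topology A) (\<lambda>z. z i)"
    unfolding cantor_topology_def by (rule continuous_map_product_projection) simp
  \<comment> \<open>The intersection covers the case \<open>a \<notin> A\<close>, where the cylinder
    is empty.\<close>
  moreover have "closedin (discrete_topology A) (A \<inter> {a})" by simp
  ultimately have "closedin (cantor_topology A) {z \<in> topspace (cantor_topology A). z i \<in> A \<inter> {a}}"
    by (rule closedin_continuous_map_preimage)
  moreover have "{z \<in> topspace (cantor_topology A). z i \<in> A \<inter> {a}} = {z \<in> UNIV \<rightarrow> A. z i = a}"
    by (auto simp: topspace_cantor_topology)
  ultimately show ?thesis by simp
qed

text \<open>The points of \<open>Z\<close> meeting the first \<open>n\<close> demands form a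
  decreasing sequence of nonempty closed sets in a compact space. \<open>I\<close> restricts the
  demands, so that the connecting windows can stay free.\<close>

lemma subshift_point_from_prefixes:
  assumes "finite A" and "subshift A Z"
    and prefixes: "\<And>n. \<exists>z\<in>Z. \<forall>i<n. i \<in> I \<longrightarrow> z i = y i"
  shows "\<exists>z\<in>Z. \<forall>i\<in>I. z i = y i"
proof -
  have Z: "closedin (cantor_topology A) Z" using assms(2) by (simp add: subshift_def)
  then have ZA: "Z \<subseteq> UNIV \<rightarrow> A" using closedin_subset topspace_cantor_topology by metis
  define C where "C n = {z \<in> Z. \<forall>i<n. i \<in> I \<longrightarrow> z i = y i}" for n
  have "closedin (cantor_topology A) (C n)" for n
  proof (induction n)
    case 0
    then show ?case using Z by (simp add: C_def)
  next
    case (Suc n)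
    have "C (Suc n) = (if n \<in> I then C n \<inter> {z \<in> UNIV \<rightarrow> A. z n = y n} else C n)"
      using ZA by (auto simp: C_def less_Suc_eq)
    then show ?case using Suc closedin_Int[OF Suc closedin_cantor_cylinder[of A n "y n"]] by simp
  qed
  moreover have "C n \<noteq> {}" for n using prefixes[of n] by (auto simp: C_def)
  moreover have "decseq C" by (auto simp: decseq_def C_def)
  ultimately have "(\<Inter>n. C n) \<noteq> {}"
    using compact_space_imp_nest[OF compact_space_cantor_topology[OF assms(1)]] by blast
  then obtain z where "\<And>n. z \<in> C n" by blast
  then have "z \<in> Z" and "\<And>i. i \<in> I \<Longrightarrow> z i = y i" unfolding C_def by blast+
  then show ?thesis by blast
qed

text \<open>The glued point differs from \<open>y\<close> only in the windows after the cuts, which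
  cost at most \<open>m\<close> coordinates per cut. As \<open>m\<close> is fixed and the cuts have
  density zero, the distance vanishes.\<close>

lemma mixing_glue:
  assumes "finite A" and Z: "subshift A Z" "mixing Z"
    and "0 \<in> D"
    and pieces: "\<And>a b. {a<..<b} \<inter> D = {} \<Longrightarrow> \<exists>p\<in>Z. \<forall>i\<in>{a..<b}. y i = p i"
    and density: "\<And>n. real (card (D \<inter> {0..n})) \<le> b n" "(\<lambda>n. b n / real (n + 1)) \<longlonglongrightarrow> 0"
  shows "\<exists>z\<in>Z. besicovitch_dist z y = 0"
proof -
  obtain m where "\<And>u v. u \<in> language Z \<Longrightarrow> v \<in> language Z \<Longrightarrow>
       \<exists>w. length w = m \<and> u @ w @ v \<in> language Z"
    using Z(2) by (meson mixing_def order_refl)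
  then have "\<exists>z\<in>Z. \<forall>i<n. i \<in> {i. \<forall>j\<in>D. i \<notin> {j..<j + m}} \<longrightarrow> z i = y i" for n
    using glue_prefix[OF Z(1) _ _ assms(4) pieces, of m n] Z(2) by (simp add: mixing_def)
  then obtain z where z: "z \<in> Z" "\<And>i. \<forall>j\<in>D. i \<notin> {j..<j + m} \<Longrightarrow> z i = y i"
    using subshift_point_from_prefixes[OF assms(1) Z(1), of "{i. \<forall>j\<in>D. i \<notin> {j..<j + m}}" y]
    by blast
  have "besicovitch_dist z y \<le> 0"
  proof (rule besicovitch_dist_le)
    fix n
    \<comment> \<open>A disagreement at \<open>i\<close> lies in the window of a cut
      \<open>j \<le> i\<close>, so only cuts up to \<open>n\<close> count.\<close>
    have "{i \<in> {0..n}. z i \<noteq> y i} \<subseteq> (\<Union>j\<in>D \<inter> {0..n}. {j..<j + m})"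
    proof
      fix i assume i: "i \<in> {i \<in> {0..n}. z i \<noteq> y i}"
      then obtain j where "j \<in> D" "i \<in> {j..<j + m}" using z(2) by blast
      then show "i \<in> (\<Union>j\<in>D \<inter> {0..n}. {j..<j + m})"
        using i by (intro UN_I[of j]) auto
    qed
    then have "card {i \<in> {0..n}. z i \<noteq> y i} \<le> card (\<Union>j\<in>D \<inter> {0..n}. {j..<j + m})"
      by (intro card_mono) auto
    also have "\<dots> \<le> (\<Sum>j\<in>D \<inter> {0..n}. card {j..<j + m})"
      by (rule card_UN_le) auto
    also have "\<dots> = m * card (D \<inter> {0..n})" by simp
    finally have "real (card {i \<in> {0..n}. z i \<noteq> y i}) \<le> real m * real (card (D \<inter> {0..n}))"
      by (simp only: of_nat_le_iff flip: of_nat_mult)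
    also have "\<dots> \<le> real m * b n" using density(1) by (intro mult_left_mono) auto
    finally show "real (card {i \<in> {0..n}. z i \<noteq> y i}) \<le> real m * b n" .
  next
    show "(\<lambda>n. real m * b n / real (n + 1)) \<longlonglongrightarrow> 0"
      using tendsto_mult_left[OF density(2), of "real m"] by simp
  qed
  then show ?thesis using z(1) besicovitch_dist_nonneg[of z y] by (intro bexI[of _ z]) auto
qed

section \<open>Interleaving along square roots\<close>

text \<open>For \<open>t\<close> between 0 and 1 this takes, from each block between
  \<open>k\<^sup>2\<close> and \<open>(k + 1)\<^sup>2\<close>, the initial part below
  \<open>(k + t)\<^sup>2\<close>. That is asymptotically a fraction \<open>t\<close> of a block,
  while blocks grow and their boundaries become sparse.\<close>

definition sqrt_phase :: "real \<Rightarrow> nat set" where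
  "sqrt_phase t = {i. frac (sqrt (real i)) < t}"

definition interleave :: "nat set \<Rightarrow> (nat \<Rightarrow> 'a) \<Rightarrow> (nat \<Rightarrow> 'a) \<Rightarrow> nat \<Rightarrow> 'a" where
  "interleave S u v = (\<lambda>i. if i \<in> S then u i else v i)"

lemma sqrt_phase_0: "sqrt_phase 0 = {}" and sqrt_phase_1: "sqrt_phase 1 = UNIV"
  by (auto simp: sqrt_phase_def frac_lt_1 frac_ge_0 not_less)

text \<open>The boundaries of \<open>sqrt_phase t\<close> are the squares and the numbers \<open>\<lceil>(k + t)\<^sup>2\<rceil>\<close>.\<close>

definition sqrt_cuts :: "real \<Rightarrow> nat set" where
  "sqrt_cuts t = range (\<lambda>k. k\<^sup>2) \<union> range (\<lambda>k. nat \<lceil>(real k + t)\<^sup>2\<rceil>)"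

text \<open>Membership can change only on entering a new block, at a square, or on crossing
  \<open>(k + t)\<^sup>2\<close>, at the ceiling of that number. Both events are cuts.\<close>

lemma sqrt_phase_Suc_iff:
  assumes "0 \<le> t" and "Suc i \<notin> sqrt_cuts t"
  shows "Suc i \<in> sqrt_phase t \<longleftrightarrow> i \<in> sqrt_phase t"
proof -
  define k where "k = nat \<lfloor>sqrt (real i)\<rfloor>"
  have k: "real k \<le> sqrt i" "sqrt i < real k + 1"
    unfolding k_def by (auto simp: of_nat_nat)
  have "real i < (real k + 1)\<^sup>2"
    using k(2) real_sqrt_less_iff[of "real i" "(real k + 1)\<^sup>2"] by simp
  then have "real i < real ((k + 1)\<^sup>2)" by (simp add: add.commute)
  then have "i < (k + 1)\<^sup>2" by (simp only: of_nat_less_iff)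
  moreover have "Suc i \<noteq> (k + 1)\<^sup>2" using assms(2) by (auto simp: sqrt_cuts_def)
  ultimately have "Suc i < (k + 1)\<^sup>2" by linarith
  then have "real (Suc i) < real ((k + 1)\<^sup>2)" by (simp only: of_nat_less_iff)
  then have "real (Suc i) < (real k + 1)\<^sup>2" by (simp add: add.commute)
  then have "sqrt (Suc i) < real k + 1" by (simp add: real_less_lsqrt)
  moreover have "real k \<le> sqrt (Suc i)"
    using k(1) real_sqrt_le_mono[of "real i" "real (Suc i)"] by linarith
  \<comment> \<open>With no square at \<open>Suc i\<close>, both indices lie in the same block, and
    membership becomes a comparison with \<open>(k + t)\<^sup>2\<close>.\<close>
  ultimately have "\<lfloor>sqrt (Suc i)\<rfloor> = int k" "\<lfloor>sqrt i\<rfloor> = int k"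
    using k by (auto intro!: floor_unique)
  then have mem: "j \<in> sqrt_phase t \<longleftrightarrow> sqrt (real j) < real k + t" if "j = i \<or> j = Suc i" for j
    using that by (auto simp: sqrt_phase_def frac_def)
  have sq: "sqrt (real j) < real k + t \<longleftrightarrow> real j < (real k + t)\<^sup>2" for j
    using real_sqrt_less_iff[of "real j" "(real k + t)\<^sup>2"] assms(1) by simp
  have "Suc i \<noteq> nat \<lceil>(real k + t)\<^sup>2\<rceil>" using assms(2) by (auto simp: sqrt_cuts_def)
  then have "real (Suc i) < (real k + t)\<^sup>2 \<longleftrightarrow> real i < (real k + t)\<^sup>2"
    by (auto simp: nat_eq_iff2 ceiling_unique) linarith
  then show ?thesis using mem sq by simp
qed

lemma sqrt_phase_constant:
  assumes "0 \<le> t" and "{a<..<b} \<inter> sqrt_cuts t = {}" and "a \<le> i" and "i < b"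
  shows "i \<in> sqrt_phase t \<longleftrightarrow> a \<in> sqrt_phase t"
  using assms(3,4)
proof (induction i rule: dec_induct)
  case (step i)
  then have "Suc i \<in> {a<..<b}" by simp
  then have "Suc i \<notin> sqrt_cuts t" using assms(2) by blast
  then show ?case using step sqrt_phase_Suc_iff[OF assms(1)] by auto
qed simp

text \<open>A cut up to \<open>n\<close> from either family has index \<open>k\<close> at most the
  integer part of the square root of \<open>n\<close>, so each family contributes at most
  \<open>sqrt n + 1\<close> cuts.\<close>

lemma card_sqrt_cuts:
  assumes "0 \<le> t"
  shows "real (card (sqrt_cuts t \<inter> {0..n})) \<le> 2 * (sqrt n + 1)"
proof -
  define K where "K = nat \<lfloor>sqrt (real n)\<rfloor>"
  have le: "k \<le> K" if "(real k)\<^sup>2 \<le> real n" for k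
  proof -
    have "real k \<le> sqrt n" using that by (rule real_le_rsqrt)
    then show ?thesis unfolding K_def by (simp add: le_nat_floor)
  qed
  have "k \<le> K" if "nat \<lceil>(real k + t)\<^sup>2\<rceil> \<le> n" for k
  proof (rule le)
    have "(real k)\<^sup>2 \<le> (real k + t)\<^sup>2" using assms by (intro power_mono) auto
    also have "\<dots> \<le> real n" using that by linarith
    finally show "(real k)\<^sup>2 \<le> real n" .
  qed
  moreover have "k \<le> K" if "k\<^sup>2 \<le> n" for k
  proof (rule le)
    have "real (k\<^sup>2) \<le> real n" using that by (simp only: of_nat_le_iff)
    then show "(real k)\<^sup>2 \<le> real n" by simp
  qed
  ultimately have "sqrt_cuts t \<inter> {0..n} \<subseteq>
      (\<lambda>k. k\<^sup>2) ` {..K} \<union> (\<lambda>k. nat \<lceil>(real k + t)\<^sup>2\<rceil>) ` {..K}" (is "_ \<subseteq> ?P \<union> ?Q")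
    by (auto simp: sqrt_cuts_def)
  then have "card (sqrt_cuts t \<inter> {0..n}) \<le> card (?P \<union> ?Q)" by (intro card_mono) auto
  also have "\<dots> \<le> card ?P + card ?Q" by (rule card_Un_le)
  also have "\<dots> \<le> card {..K} + card {..K}" by (intro add_mono card_image_le) auto
  finally have "real (card (sqrt_cuts t \<inter> {0..n})) \<le> real (2 * (K + 1))"
    by (simp only: of_nat_le_iff) simp
  also have "\<dots> \<le> 2 * (sqrt n + 1)" by (simp add: K_def of_nat_nat)
  finally show ?thesis .
qed

text \<open>Between consecutive cuts the interleaving copies just one of \<open>u\<close> and
  \<open>v\<close>, both in \<open>Z\<close>, and there are only \<open>O(sqrt n)\<close> cuts up to
  \<open>n\<close>; so gluing applies.\<close>

lemma mixing_interleave: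
  assumes "finite A" "subshift A Z" "mixing Z" "0 \<le> t" "u \<in> Z" "v \<in> Z"
  shows "\<exists>z\<in>Z. besicovitch_dist z (interleave (sqrt_phase t) u v) = 0"
proof (rule mixing_glue[OF assms(1-3), where D = "sqrt_cuts t"])
  show "0 \<in> sqrt_cuts t" unfolding sqrt_cuts_def by (auto intro!: image_eqI[of _ _ 0])
next
  fix a b assume ab: "{a<..<b} \<inter> sqrt_cuts t = {}"
  show "\<exists>p\<in>Z. \<forall>i\<in>{a..<b}. interleave (sqrt_phase t) u v i = p i"
  proof
    show "(if a \<in> sqrt_phase t then u else v) \<in> Z" using assms(5,6) by simp
    show "\<forall>i\<in>{a..<b}. interleave (sqrt_phase t) u v i = (if a \<in> sqrt_phase t then u else v) i"
    proof
      fix i assume "i \<in> {a..<b}"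
      then have "i \<in> sqrt_phase t \<longleftrightarrow> a \<in> sqrt_phase t"
        by (intro sqrt_phase_constant[OF assms(4) ab]) auto
      then show "interleave (sqrt_phase t) u v i = (if a \<in> sqrt_phase t then u else v) i"
        by (simp add: interleave_def)
    qed
  qed
next
  show "real (card (sqrt_cuts t \<inter> {0..n})) \<le> 2 * (sqrt n + 1)" for n
    using assms(4) by (rule card_sqrt_cuts)
  show "(\<lambda>n. 2 * (sqrt (real n) + 1) / real (n + 1)) \<longlonglongrightarrow> 0"
    by real_asymp
qed

section \<open>Lipschitz dependence on time\<close>

lemma card_nat_interval_le:
  fixes a b :: real
  assumes "0 \<le> a" and "a \<le> b"
  shows "real (card {i. a \<le> real i \<and> real i < b}) \<le> b - a + 1"
proof -
  have "{i. a \<le> real i \<and> real i < b} \<subseteq> {nat \<lceil>a\<rceil>..<nat \<lceil>b\<rceil>}"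
    by (auto simp: less_ceiling_iff zless_nat_eq_int_zless nat_le_iff ceiling_le_iff)
  then have "card {i. a \<le> real i \<and> real i < b} \<le> card {nat \<lceil>a\<rceil>..<nat \<lceil>b\<rceil>}"
    by (intro card_mono) auto
  also have "\<dots> = nat \<lceil>b\<rceil> - nat \<lceil>a\<rceil>" by simp
  finally have "real (card {i. a \<le> real i \<and> real i < b}) \<le> real (nat \<lceil>b\<rceil> - nat \<lceil>a\<rceil>)"
    by (simp only: of_nat_le_iff)
  also have "\<dots> \<le> b - a + 1"
    using assms by linarith
  finally show ?thesis .
qed

text \<open>Block \<open>k\<close> contributes about \<open>(t - s) * (2 * k + t + s)\<close>
  indices, with rounding error at most 1. Summing over the blocks up to \<open>n\<close> gives
  leading term \<open>(t - s) * n\<close> and an error of order \<open>sqrt n\<close>.\<close>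

lemma card_sqrt_phase_diff:
  fixes n :: nat
  assumes "0 \<le> s" "s \<le> t" "t \<le> 1"
  shows "real (card {i \<in> {0..n}. s \<le> frac (sqrt i) \<and> frac (sqrt i) < t})
    \<le> (t - s) * ((sqrt n + 1) * (sqrt n + 2)) + (sqrt n + 1)"
proof -
  define K where "K = nat \<lfloor>sqrt (real n)\<rfloor>"
  \<comment> \<open>\<open>B k\<close> is the part of block \<open>k\<close> with phase from
    \<open>s\<close> up to \<open>t\<close>, rewritten as an interval of integers.\<close>
  define B where "B k = {i::nat. (real k + s)\<^sup>2 \<le> real i \<and> real i < (real k + t)\<^sup>2}" for k :: nat
  have finB: "finite (B k)" for k
  proof -
    have "B k \<subseteq> {..nat \<lceil>(real k + t)\<^sup>2\<rceil>}" unfolding B_def by (auto simp: le_nat_iff) linarith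
    then show ?thesis by (rule finite_subset) simp
  qed
  have cardB: "real (card (B k)) \<le> (t - s) * (2 * real k + 2) + 1" for k
  proof -
    have "real (card (B k)) \<le> (real k + t)\<^sup>2 - (real k + s)\<^sup>2 + 1"
      unfolding B_def using assms by (intro card_nat_interval_le power_mono) auto
    also have "\<dots> = (t - s) * (2 * real k + (t + s)) + 1"
      by (simp add: power2_eq_square algebra_simps)
    also have "\<dots> \<le> (t - s) * (2 * real k + 2) + 1"
      using assms by (intro add_mono mult_left_mono) auto
    finally show ?thesis .
  qed
  have "{i \<in> {0..n}. s \<le> frac (sqrt i) \<and> frac (sqrt i) < t} \<subseteq> (\<Union>k\<in>{..K}. B k)"
  proof
    fix i assume i: "i \<in> {i \<in> {0..n}. s \<le> frac (sqrt i) \<and> frac (sqrt i) < t}"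
    define k where "k = nat \<lfloor>sqrt (real i)\<rfloor>"
    have fr: "sqrt i = real k + frac (sqrt i)" by (simp add: frac_def k_def of_nat_nat)
    have "(real k + s)\<^sup>2 \<le> (sqrt i)\<^sup>2" using i fr assms by (intro power_mono) auto
    moreover have "(sqrt i)\<^sup>2 < (real k + t)\<^sup>2" using i fr by (intro power_strict_mono) auto
    moreover have "k \<le> K" unfolding k_def K_def using i by (intro nat_mono floor_mono) auto
    ultimately show "i \<in> (\<Union>k\<in>{..K}. B k)" by (auto simp: B_def)
  qed
  then have "card {i \<in> {0..n}. s \<le> frac (sqrt i) \<and> frac (sqrt i) < t} \<le> card (\<Union>k\<in>{..K}. B k)"
    using finB by (intro card_mono) auto
  also have "\<dots> \<le> (\<Sum>k\<le>K. card (B k))" by (rule card_UN_le) simp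
  finally have "real (card {i \<in> {0..n}. s \<le> frac (sqrt i) \<and> frac (sqrt i) < t})
      \<le> (\<Sum>k\<le>K. real (card (B k)))"
    by (simp only: of_nat_le_iff flip: of_nat_sum)
  also have "\<dots> \<le> (\<Sum>k\<le>K. (t - s) * (2 * real k + 2) + 1)"
    by (intro sum_mono cardB)
  also have "\<dots> = (t - s) * ((real K + 1) * (real K + 2)) + (real K + 1)"
    by (induction K) (auto simp: algebra_simps)
  also have "\<dots> \<le> (t - s) * ((sqrt n + 1) * (sqrt n + 2)) + (sqrt n + 1)"
    using assms by (intro add_mono mult_left_mono mult_mono) (auto simp: K_def of_nat_nat)
  finally show ?thesis .
qed

text \<open>The two interleavings can differ only at phases in the half-open interval from
  \<open>s\<close> to \<open>t\<close>, whose indices have upper density at most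
  \<open>t - s\<close>.\<close>

lemma besicovitch_dist_interleave_mono:
  assumes "0 \<le> s" "s \<le> t" "t \<le> 1"
  shows "besicovitch_dist (interleave (sqrt_phase s) u v) (interleave (sqrt_phase t) u v) \<le> t - s"
proof (rule besicovitch_dist_le)
  fix n
  have "card {i \<in> {0..n}. interleave (sqrt_phase s) u v i \<noteq> interleave (sqrt_phase t) u v i}
      \<le> card {i \<in> {0..n}. s \<le> frac (sqrt i) \<and> frac (sqrt i) < t}"
    using assms(2) by (intro card_mono) (auto simp: interleave_def sqrt_phase_def split: if_splits)
  then show "real (card {i \<in> {0..n}. interleave (sqrt_phase s) u v i \<noteq> interleave (sqrt_phase t) u v i})
      \<le> (t - s) * ((sqrt n + 1) * (sqrt n + 2)) + (sqrt n + 1)"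
    using card_sqrt_phase_diff[OF assms, of n] by linarith
next
  show "(\<lambda>n. ((t - s) * ((sqrt (real n) + 1) * (sqrt n + 2)) + (sqrt n + 1)) / real (n + 1))
      \<longlonglongrightarrow> t - s"
  proof -
    have "(\<lambda>n. ((sqrt (real n) + 1) * (sqrt n + 2)) / real (n + 1)) \<longlonglongrightarrow> 1" by real_asymp
    moreover have "(\<lambda>n. (sqrt (real n) + 1) / real (n + 1)) \<longlonglongrightarrow> 0" by real_asymp
    ultimately have "(\<lambda>n. (t - s) * (((sqrt (real n) + 1) * (sqrt n + 2)) / real (n + 1))
        + (sqrt (real n) + 1) / real (n + 1)) \<longlonglongrightarrow> (t - s) * 1 + 0"
      by (intro tendsto_intros)
    then show ?thesis by (simp add: add_divide_distrib)
  qed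
qed

text \<open>First the time moves with \<open>u\<close> and \<open>v\<close> fixed, then the
  configurations change at time \<open>t\<close>. The bound is jointly Lipschitz, which yields joint
  continuity of the homotopy.\<close>

lemma besicovitch_dist_interleave:
  assumes "s \<in> {0..1}" "t \<in> {0..1}"
  shows "besicovitch_dist (interleave (sqrt_phase s) u v) (interleave (sqrt_phase t) u' v')
    \<le> besicovitch_dist u u' + besicovitch_dist v v' + \<bar>s - t\<bar>"
proof -
  have "besicovitch_dist (interleave (sqrt_phase s) u v) (interleave (sqrt_phase t) u v) \<le> \<bar>s - t\<bar>"
    using besicovitch_dist_interleave_mono[of s t u v] besicovitch_dist_interleave_mono[of t s u v]
      assms by (cases "s \<le> t") (auto simp: besicovitch_dist_commute)
  moreover have "besicovitch_dist (interleave (sqrt_phase t) u v) (interleave (sqrt_phase t) u' v')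
      \<le> besicovitch_dist u u' + besicovitch_dist v v'"
    by (rule besicovitch_dist_le_add) (auto simp: interleave_def split: if_splits)
  ultimately show ?thesis
    using besicovitch_dist_triangle[of "interleave (sqrt_phase s) u v"
        "interleave (sqrt_phase t) u' v'" "interleave (sqrt_phase t) u v"] by linarith
qed

text \<open>Replacing \<open>u\<close> and \<open>v\<close> by points of \<open>Z\<close> at
  distance 0 moves their interleaving by distance 0, so the result for \<open>Z\<close> carries over
  to its saturation.\<close>

lemma mixing_saturation_interleave:
  assumes "finite A" "subshift A Z" "mixing Z" "0 \<le> t"
    and "u \<in> besicovitch_saturation A Z" "v \<in> besicovitch_saturation A Z"
  shows "\<exists>z\<in>Z. besicovitch_dist z (interleave (sqrt_phase t) u v) = 0"
proof -
  obtain u' v' where uv: "u' \<in> Z" "v' \<in> Z" "besicovitch_dist u u' = 0" "besicovitch_dist v v' = 0"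
    using assms(5,6) by (auto simp: besicovitch_saturation_def)
  obtain z where z: "z \<in> Z" "besicovitch_dist z (interleave (sqrt_phase t) u' v') = 0"
    using mixing_interleave[OF assms(1-4) uv(1,2)] by blast
  have "besicovitch_dist (interleave (sqrt_phase t) u' v') (interleave (sqrt_phase t) u v)
      \<le> besicovitch_dist u u' + besicovitch_dist v v'"
    by (rule besicovitch_dist_le_add) (auto simp: interleave_def split: if_splits)
  then have "besicovitch_dist z (interleave (sqrt_phase t) u v) \<le> 0"
    using besicovitch_dist_triangle[of z "interleave (sqrt_phase t) u v"
        "interleave (sqrt_phase t) u' v'"] z(2) uv(3,4) by linarith
  then show ?thesis
    using z(1) besicovitch_dist_nonneg[of z] by (intro bexI[of _ z]) (auto intro: antisym)
qed

section \<open>Construction of the homotopy\<close>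

theorem lemma2:
  fixes A :: "'a set" and Y :: "(nat \<Rightarrow> 'a) set"
    and X :: "'x topology" and f g :: "'x \<Rightarrow> nat \<Rightarrow> 'a"
  assumes "finite A"
    and "sofic A Y"
    and "\<And>Z. transitive_component A Y Z \<Longrightarrow> mixing Z"
    and "continuous_map X (subtopology (besicovitch_topology A) Y) f"
    and "continuous_map X (subtopology (besicovitch_topology A) Y) g"
    and "\<And>x. x \<in> topspace X \<Longrightarrow> \<exists>Z. transitive_component A Y Z \<and>
           f x \<in> besicovitch_saturation A Z \<and> g x \<in> besicovitch_saturation A Z"
  shows "homotopic_with (\<lambda>_. True) X (subtopology (besicovitch_topology A) Y) f g"
proof -
  \<comment> \<open>\<open>g x\<close> comes first because the phase set grows from empty to
    everything: \<open>H 0 x = f x\<close> and \<open>H 1 x = g x\<close>. In general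
    \<open>H t x\<close> need not lie in \<open>Y\<close>.\<close>
  define H where "H t x = interleave (sqrt_phase t) (g x) (f x)" for t x
  have contf: "continuous_map X (besicovitch_topology A) f" "f \<in> topspace X \<rightarrow> Y"
    and contg: "continuous_map X (besicovitch_topology A) g" "g \<in> topspace X \<rightarrow> Y"
    using assms(4,5) by (auto simp: continuous_map_in_subtopology)
  have YA: "Y \<subseteq> UNIV \<rightarrow> A"
    using assms(2) closedin_subset[of "cantor_topology A" Y]
    by (simp add: sofic_def subshift_def topspace_cantor_topology)
  \<comment> \<open>At the end times the value must be exactly \<open>f x\<close> or
    \<open>g x\<close>, not merely at distance 0. Outside the domain any value will do, which makes
    the choice below total.\<close>
  have "\<exists>y. (t = 0 \<longrightarrow> y = f x) \<and> (t = 1 \<longrightarrow> y = g x) \<and>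
      (t \<in> {0..1} \<and> x \<in> topspace X \<longrightarrow> y \<in> Y \<and> besicovitch_dist y (H t x) = 0)" for t x
  proof -
    consider "t = 0" | "t = 1" | "t \<notin> {0..1} \<or> x \<notin> topspace X" "t \<noteq> 0" "t \<noteq> 1"
      | "t \<noteq> 0" "t \<noteq> 1" "t \<in> {0..1}" "x \<in> topspace X" by blast
    then show ?thesis
    proof cases
      case 1
      then show ?thesis using contf(2)
        by (auto simp: H_def interleave_def sqrt_phase_0 besicovitch_dist_refl)
    next
      case 2
      then show ?thesis using contg(2)
        by (auto simp: H_def interleave_def sqrt_phase_1 besicovitch_dist_refl)
    next
      case 4
      obtain Z where Z: "transitive_component A Y Z"
        "f x \<in> besicovitch_saturation A Z" "g x \<in> besicovitch_saturation A Z"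
        using assms(6)[OF 4(4)] by blast
      then have sub: "subshift A Z" "Z \<subseteq> Y" by (auto simp: transitive_component_def)
      obtain z where "z \<in> Z" "besicovitch_dist z (H t x) = 0"
        using mixing_saturation_interleave[OF assms(1) sub(1) assms(3)[OF Z(1)] _ Z(3,2), of t] 4(3)
        by (auto simp: H_def)
      then show ?thesis using 4 sub(2) by auto
    qed auto
  qed
  then obtain h where h: "\<And>x. h 0 x = f x" "\<And>x. h 1 x = g x"
    and hY: "\<And>t x. t \<in> {0..1} \<Longrightarrow> x \<in> topspace X \<Longrightarrow> h t x \<in> Y"
    and hH: "\<And>t x. t \<in> {0..1} \<Longrightarrow> x \<in> topspace X \<Longrightarrow> besicovitch_dist (h t x) (H t x) = 0"
    by metis
  let ?P = "prod_topology (top_of_set {0..1::real}) X"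
  \<comment> \<open>The components and points were chosen independently for each \<open>t\<close>
    and \<open>x\<close>, yet \<open>h\<close> inherits the estimate for \<open>H\<close>, since
    each chosen value is at distance 0 from \<open>H t x\<close>.\<close>
  have dist_h: "besicovitch_dist (h s x) (h t y)
      \<le> besicovitch_dist (g x) (g y) + besicovitch_dist (f x) (f y) + \<bar>s - t\<bar>"
    if "s \<in> {0..1}" "t \<in> {0..1}" "x \<in> topspace X" "y \<in> topspace X" for s t x y
    using besicovitch_dist_interleave[OF that(1,2), of "g x" "f x" "g y" "f y", folded H_def]
      besicovitch_dist_triangle[of "h s x" "h t y" "H s x"]
      besicovitch_dist_triangle[of "H s x" "h t y" "H t y"]
      hH[OF that(1,3)] hH[OF that(2,4)] besicovitch_dist_commute[of "h t y" "H t y"]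
    by linarith
  have "continuous_map ?P (besicovitch_topology A) (\<lambda>(t, x). h t x)"
    unfolding continuous_map_besicovitch_iff
  proof (intro conjI ballI allI impI)
    show "(\<lambda>(t, x). h t x) \<in> topspace ?P \<rightarrow> (UNIV \<rightarrow> A)"
      using hY YA by fastforce
    fix p and e :: real assume "p \<in> topspace ?P" and e: "e > 0"
    then obtain s x where p: "p = (s, x)" "s \<in> {0..1}" "x \<in> topspace X"
      by (cases p) auto
    have e3: "e / 3 > 0" using e by simp
    obtain U where U: "openin X U" "x \<in> U" "\<And>y. y \<in> U \<Longrightarrow> besicovitch_dist (f x) (f y) < e / 3"
      using contf(1)[unfolded continuous_map_besicovitch_iff, THEN conjunct2,
          THEN bspec, OF p(3), THEN spec, THEN mp, OF e3] by blast
    obtain V where V: "openin X V" "x \<in> V" "\<And>y. y \<in> V \<Longrightarrow> besicovitch_dist (g x) (g y) < e / 3"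
      using contg(1)[unfolded continuous_map_besicovitch_iff, THEN conjunct2,
          THEN bspec, OF p(3), THEN spec, THEN mp, OF e3] by blast
    \<comment> \<open>One third of \<open>e\<close> each is allotted to time, \<open>f\<close> and
      \<open>g\<close>.\<close>
    define W where "W = ({0..1} \<inter> ball s (e / 3)) \<times> (U \<inter> V)"
    have "openin ?P W"
      unfolding W_def using U(1) V(1)
      by (auto simp: openin_prod_Times_iff intro: openin_Int openin_open_Int)
    moreover have "p \<in> W" using p U(2) V(2) e by (auto simp: W_def)
    moreover have "besicovitch_dist (case p of (t, x) \<Rightarrow> h t x) (case q of (t, x) \<Rightarrow> h t x) < e"
      if qW: "q \<in> W" for q
    proof -
      obtain t y where q: "q = (t, y)" "t \<in> {0..1}" "\<bar>s - t\<bar> < e / 3" "y \<in> U" "y \<in> V"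
        using qW by (auto simp: W_def dist_real_def)
      then have y: "y \<in> topspace X" using U(1) openin_subset by blast
      then show ?thesis
        using dist_h[OF p(2) q(2) p(3) y] U(3)[OF q(4)] V(3)[OF q(5)] q(3) unfolding p(1) q(1)
        by simp
    qed
    ultimately show "\<exists>W. openin ?P W \<and> p \<in> W \<and> (\<forall>q\<in>W.
        besicovitch_dist (case p of (t, x) \<Rightarrow> h t x) (case q of (t, x) \<Rightarrow> h t x) < e)"
      by blast
  qed
  then have "continuous_map ?P (subtopology (besicovitch_topology A) Y) (\<lambda>(t, x). h t x)"
    using hY by (auto simp: continuous_map_in_subtopology)
  then show ?thesis
    unfolding homotopic_with_def using h by (intro exI[of _ "\<lambda>(t, x). h t x"]) auto
qed

end
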